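(* Let $l\geq 0$ be an integer, $\lambda\in\mathbb{R}$ and $\mu\geq 0$. The equation $$z^2E''+\big((l+1)z+\mu(1-z^2)\big)E'+\big(\lambda-\mu(l+1)z\big)E=0$$ has an entire solution $E$ that is not identically zero if and only if $\xi_l(\lambda,\mu)=0$, where $\xi_l$ is the function defined in the context by an infinite matrix product.
   Context: The equation is a linear ordinary differential equation for a function $E=E(z)$ of the complex variable $z$; primes denote $d/dz$. An entire solution is a solution holomorphic on all of $\mathbb{C}$. For an integer $l\geq0$, $\lambda\in\mathbb{R}$ and $\mu\geq0$, set for integers $j\geq l+1$ $$M_j=\begin{pmatrix}1+\frac{\lambda}{j(j-l)} & \frac{\mu^2}{j(j-l)}\\ 1&0\end{pmatrix},\qquad R_{l+1}=\prod_{j=l+1}^{\infty}M_j=\lim_{N\to\infty}M_{l+1}M_{l+2}\cdots M_N,$$ where factors with bigger indices are placed to the right of those with smaller indices (this infinite product is known to converge). Then $$\xi_l(\lambda,\mu)=\begin{pmatrix}\lambda & \mu^2\end{pmatrix}R_{l+1}\begin{pmatrix}1\\0\end{pmatrix}.$$ *)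

theory Defs
  imports "HOL-Complex_Analysis.Complex_Analysis"
begin

definition M_mat :: "nat \<Rightarrow> real \<Rightarrow> real \<Rightarrow> nat \<Rightarrow> real^2^2" where
  "M_mat l lam mu j =
     vector [vector [1 + lam / (real j * (real j - real l)), mu\<^sup>2 / (real j * (real j - real l))],
             vector [1, 0]]"

text \<open>The ordered partial product \<open>M\<^sub>l\<^sub>+\<^sub>1 M\<^sub>l\<^sub>+\<^sub>2 \<dots> M\<^sub>l\<^sub>+\<^sub>n\<close> of \<open>n\<close> factors, with new factors
  appended on the right.\<close>

primrec M_prod :: "nat \<Rightarrow> real \<Rightarrow> real \<Rightarrow> nat \<Rightarrow> real^2^2" where
  "M_prod l lam mu 0 = mat 1"
| "M_prod l lam mu (Suc n) = M_prod l lam mu n ** M_mat l lam mu (l + Suc n)"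

text \<open>The infinite product \<open>R\<^sub>l\<^sub>+\<^sub>1\<close>. The partial products converge for all values of the
  parameters, so \<^const>\<open>lim\<close> is the genuine limit.\<close>

definition R_mat :: "nat \<Rightarrow> real \<Rightarrow> real \<Rightarrow> real^2^2" where
  "R_mat l lam mu = lim (M_prod l lam mu)"

definition xi :: "nat \<Rightarrow> real \<Rightarrow> real \<Rightarrow> real" where
  "xi l lam mu = (vector [lam, mu\<^sup>2] v* R_mat l lam mu) \<bullet> vector [1, 0]"

definition solves_ode_at :: "nat \<Rightarrow> real \<Rightarrow> real \<Rightarrow> (complex \<Rightarrow> complex) \<Rightarrow> complex \<Rightarrow> bool" where
  "solves_ode_at l lam mu E z \<longleftrightarrow>
     z\<^sup>2 * deriv (deriv E) z
     + ((of_nat l + 1) * z + of_real mu * (1 - z\<^sup>2)) * deriv E z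
     + (of_real lam - of_real mu * (of_nat l + 1) * z) * E z = 0"

definition entire_solution :: "nat \<Rightarrow> real \<Rightarrow> real \<Rightarrow> (complex \<Rightarrow> complex) \<Rightarrow> bool" where
  "entire_solution l lam mu E \<longleftrightarrow>
     E holomorphic_on UNIV \<and> (\<forall>z. solves_ode_at l lam mu E z)"

end

theory Submission
  imports Defs
begin

text \<open>
  Inserting a power series \<open>E = (\<Sum>n. a n * z ^ n)\<close> into the equation gives the three-term
  recurrence
  \<open>(n (n + l) + lam) a n + mu (n + 1) a (n + 1) - mu (n + l) a (n - 1) = 0\<close>, where \<open>a (-1) = 0\<close>.
  Since an entire function is its own Taylor series at \<open>0\<close>, the question is whether this recurrence
  has a nonzero solution whose series converges everywhere (\<open>ex_entire_solution_iff\<close>).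

  Let \<open>mu > 0\<close>. Then \<open>a 0\<close> determines the whole sequence; with \<open>a 0 = 1\<close>, removing the factor
  \<open>(-1) ^ (n + 1) * coeff_scale l mu n\<close> from \<open>a (n + 1)\<close> turns the recurrence into multiplication
  of the row vector \<open>(lam, mu\<^sup>2)\<close> by \<open>M\<^sub>l\<^sub>+\<^sub>1, M\<^sub>l\<^sub>+\<^sub>2, \<dots>\<close>: the number \<open>x n\<close> that is left of
  \<open>a (n + 1)\<close> is the first entry of the vector after \<open>n\<close> factors
  (\<open>frobenius_recurrence_iff_xi_row\<close>), and its limit is \<open>\<xi>\<^sub>l\<close>. The removed factor grows like a
  factorial, up to a geometric factor. If \<open>\<xi>\<^sub>l \<noteq> 0\<close>, so do the coefficients, and the series diverges.

  If \<open>\<xi>\<^sub>l = 0\<close>, the recurrence for \<open>x\<close> forces its solution to be the small one. The sum \<open>w\<close> of the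
  two entries \<open>x\<close>, \<open>y\<close> of the row vector changes only by a summable multiple of \<open>x\<close> in each step, so
  when everything tends to \<open>0\<close>, the tail of these increments bounds \<open>w\<close> by a small multiple of the
  supremum of the later \<open>\<bar>x\<bar>\<close>. Hence \<open>\<bar>x\<bar> \<le> 2 * \<bar>y\<bar>\<close> from some index on
  (\<open>perturbed_recurrence_vanishing_limit\<close>). In terms of the coefficients this reads
  \<open>(n + 1) * \<bar>a (n + 1)\<bar> \<le> 2 * mu * \<bar>a n\<bar>\<close>, which makes the series converge everywhere.

  For \<open>mu = 0\<close> the recurrence decouples: a nonzero solution exists iff \<open>k (k + l) + lam = 0\<close> for some
  \<open>k\<close>, and the solution can be taken to be the monomial \<open>z ^ k\<close>. Here \<open>\<xi>\<^sub>l\<close> is \<open>lam\<close> times an infinite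
  product of numbers, which vanishes only if one of its factors does; this follows again from
  \<open>\<bar>x\<bar> \<le> 2 * \<bar>y\<bar>\<close>, as now \<open>y = 0\<close>.
\<close>

\<comment> \<open>The symbol denotes entries of vectors throughout.\<close>
no_notation fps_nth (infixl "$" 75)

section \<open>Recurrences with summable perturbation\<close>

text \<open>
  The step matrix is \<open>((1, 0), (1, 0)) + O(q n)\<close>, and the first summand does not increase the norm
  \<open>\<bar>x\<bar> + \<bar>y\<bar>\<close> of a row vector. The norm therefore grows at most by the factor \<open>exp (d * q n)\<close> in each
  step, and the product of these factors is finite.
\<close>
lemma perturbed_recurrence_bounded:
  fixes x y q :: "nat \<Rightarrow> real"
  assumes x: "\<And>n. x (Suc n) = (1 + b * q n) * x n + y n"
    and y: "\<And>n. y (Suc n) = c * q n * x n"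
    and q: "\<And>n. q n \<ge> 0" "summable q"
  obtains B where "\<And>n. \<bar>x n\<bar> \<le> B"
proof -
  define d where "d = \<bar>b\<bar> + \<bar>c\<bar>"
  define u where "u = (\<lambda>n. \<bar>x n\<bar> + \<bar>y n\<bar>)"
  have step: "u (Suc n) \<le> exp (d * q n) * u n" for n
  proof -
    have "\<bar>x (Suc n)\<bar> \<le> \<bar>1 + b * q n\<bar> * \<bar>x n\<bar> + \<bar>y n\<bar>"
      unfolding x by (metis abs_mult abs_triangle_ineq)
    also have "\<dots> \<le> (1 + \<bar>b\<bar> * q n) * \<bar>x n\<bar> + \<bar>y n\<bar>"
      using abs_triangle_ineq[of 1 "b * q n"] q(1)[of n]
      by (intro add_right_mono mult_right_mono) (simp_all add: abs_mult)
    finally have "u (Suc n) \<le> (1 + d * q n) * \<bar>x n\<bar> + \<bar>y n\<bar>"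
      using q(1)[of n] unfolding u_def y d_def by (simp add: abs_mult algebra_simps)
    also have "\<dots> \<le> (1 + d * q n) * u n"
      using q(1)[of n] unfolding u_def d_def by (simp add: algebra_simps)
    also have "\<dots> \<le> exp (d * q n) * u n"
      unfolding u_def by (intro mult_right_mono exp_ge_add_one_self) simp
    finally show ?thesis .
  qed
  have bound: "u n \<le> exp (d * sum q {..<n}) * u 0" for n
  proof (induction n)
    case (Suc n)
    have "u (Suc n) \<le> exp (d * q n) * u n" by (rule step)
    also have "\<dots> \<le> exp (d * q n) * (exp (d * sum q {..<n}) * u 0)"
      using Suc by (intro mult_left_mono) simp_all
    finally show ?case by (simp add: exp_add algebra_simps)
  qed simp
  have "\<bar>x n\<bar> \<le> exp (d * suminf q) * u 0" for n
  proof -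
    have "\<bar>x n\<bar> \<le> u n" by (simp add: u_def)
    also have "\<dots> \<le> exp (d * sum q {..<n}) * u 0" by (rule bound)
    also have "\<dots> \<le> exp (d * suminf q) * u 0"
      using sum_le_suminf[OF q(2), of "{..<n}"] q(1)
      by (intro mult_right_mono) (simp_all add: d_def u_def mult_left_mono)
    finally show ?thesis .
  qed
  thus ?thesis by (rule that)
qed

text \<open>
  The matrix \<open>((1, 0), (1, 0))\<close>, which is the step for \<open>q n = 0\<close>, preserves \<open>x + y\<close> as the first
  entry of the row. This makes \<open>w = x + y\<close> the right quantity: its increments are
  \<open>(b + c) * q n * x n\<close>, hence summable.
\<close>
lemma perturbed_recurrence_convergent:
  fixes x y q :: "nat \<Rightarrow> real"
  assumes x: "\<And>n. x (Suc n) = (1 + b * q n) * x n + y n"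
    and y: "\<And>n. y (Suc n) = c * q n * x n"
    and q: "\<And>n. q n \<ge> 0" "summable q"
  shows "convergent x" and "y \<longlonglongrightarrow> 0"
proof -
  obtain B where B: "\<And>n. \<bar>x n\<bar> \<le> B"
    using perturbed_recurrence_bounded[OF assms] by blast
  have qx: "summable (\<lambda>n. q n * x n)"
  proof (rule summable_comparison_test')
    show "summable (\<lambda>n. q n * B)" by (rule summable_mult2[OF q(2)])
    show "norm (q n * x n) \<le> q n * B" for n
      using q(1)[of n] B[of n] by (simp add: abs_mult mult_left_mono)
  qed
  have "(\<lambda>n. c * (q n * x n)) \<longlonglongrightarrow> 0"
    using tendsto_mult_right_zero[OF summable_LIMSEQ_zero[OF qx]] .
  hence "(\<lambda>n. y (Suc n)) \<longlonglongrightarrow> 0" by (simp add: y mult.assoc)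
  thus y0: "y \<longlonglongrightarrow> 0" by (simp add: filterlim_sequentially_Suc)
  define w where "w = (\<lambda>n. x n + y n)"
  have "summable (\<lambda>n. w (Suc n) - w n)"
    using summable_mult[OF qx, of "b + c"]
    by (simp add: w_def x y algebra_simps)
  hence "convergent (\<lambda>n. \<Sum>i<n. w (Suc i) - w i)"
    by (simp add: summable_iff_convergent)
  hence "convergent (\<lambda>n. w n - w 0)" by (simp add: sum_lessThan_telescope)
  hence "convergent w" by (simp add: convergent_diff_const_right_iff)
  hence "convergent (\<lambda>n. w n - y n)"
    using y0 by (intro convergent_diff) (auto simp: convergent_def)
  thus "convergent x" by (simp add: w_def)
qed

text \<open>
  A solution with \<open>x \<longlonglongrightarrow> 0\<close> is recessive: with \<open>S\<close> the supremum of \<open>\<bar>x m\<bar>\<close> over \<open>m \<ge> n\<close>, all later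
  contributions to \<open>x m\<close> are at most \<open>S / 2\<close> once the tail of \<open>q\<close> is small, and only \<open>\<bar>y n\<bar>\<close> is left
  to account for the other half of \<open>S\<close>.
\<close>
lemma perturbed_recurrence_vanishing_limit:
  fixes x y q :: "nat \<Rightarrow> real"
  assumes x: "\<And>n. x (Suc n) = (1 + b * q n) * x n + y n"
    and y: "\<And>n. y (Suc n) = c * q n * x n"
    and q: "\<And>n. q n \<ge> 0" "summable q"
    and lim: "x \<longlonglongrightarrow> 0"
  obtains N where "\<And>n. n \<ge> N \<Longrightarrow> \<bar>x n\<bar> \<le> 2 * \<bar>y n\<bar>"
proof -
  define d where "d = \<bar>b + c\<bar> + \<bar>c\<bar>"
  define w where "w = (\<lambda>n. x n + y n)"
  have w0: "w \<longlonglongrightarrow> 0"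
    using tendsto_add[OF lim perturbed_recurrence_convergent(2)[OF x y q]] by (simp add: w_def)
  have d0: "d \<ge> 0" by (simp add: d_def)
  \<comment> \<open>\<open>d + 1\<close> instead of \<open>d\<close> covers the case \<open>b = c = 0\<close>.\<close>
  have "1 / (2 * (d + 1)) > 0" using d0 by simp
  from suminf_exist_split[OF this q(2)] obtain N where
    N: "\<And>n. n \<ge> N \<Longrightarrow> norm (\<Sum>i. q (i + n)) < 1 / (2 * (d + 1))" by blast
  have "\<bar>x n\<bar> \<le> 2 * \<bar>y n\<bar>" if n: "n \<ge> N" for n
  proof -
    define S where "S = (SUP m\<in>{n..}. \<bar>x m\<bar>)"
    obtain B where B: "\<And>m. \<bar>x m\<bar> \<le> B"
      using perturbed_recurrence_bounded[OF x y q] by blast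
    have xS: "\<bar>x m\<bar> \<le> S" if "m \<ge> n" for m
      unfolding S_def using that B by (intro cSUP_upper) (auto intro!: bdd_aboveI)
    have S0: "S \<ge> 0" using xS[of n] by simp
    define T where "T = (\<Sum>i. q (i + n))"
    have sq: "summable (\<lambda>i. q (i + m))" for m using q(2) by (rule summable_ignore_initial_segment)
    have T: "d * T \<le> 1 / 2"
    proof -
      have "d * T \<le> d * (1 / (2 * (d + 1)))"
        using N[OF n] d0 by (intro mult_left_mono) (simp_all add: T_def)
      also have "\<dots> \<le> 1 / 2" using d0 by (simp add: field_simps)
      finally show ?thesis .
    qed
    have tail: "(\<Sum>i. q (i + m)) \<le> T" if m: "m \<ge> n" for m
    proof -
      have "T = (\<Sum>i. q (i + (m - n) + n)) + (\<Sum>i<m - n. q (i + n))"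
        unfolding T_def by (rule suminf_split_initial_segment[OF sq])
      moreover have "(\<Sum>i<m - n. q (i + n)) \<ge> 0" by (intro sum_nonneg q)
      ultimately show ?thesis using m by (simp add: add.assoc)
    qed
    have w_le: "\<bar>w m\<bar> \<le> \<bar>b + c\<bar> * S * T" if m: "m \<ge> n" for m
    proof -
      \<comment> \<open>As \<open>w\<close> tends to \<open>0\<close>, \<open>- w m\<close> is the sum of all increments from \<open>m\<close> on.\<close>
      have "(\<lambda>i. w (i + m)) \<longlonglongrightarrow> 0" using LIMSEQ_ignore_initial_segment[OF w0] .
      from telescope_sums[OF this]
      have sums: "(\<lambda>i. (b + c) * q (i + m) * x (i + m)) sums (- w m)"
        by (simp add: w_def x y algebra_simps)
      have le: "norm ((b + c) * q (i + m) * x (i + m)) \<le> \<bar>b + c\<bar> * S * q (i + m)" for i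
        using mult_left_mono[OF xS[of "i + m"], of "\<bar>b + c\<bar> * q (i + m)"] m q(1)[of "i + m"]
        by (simp add: abs_mult mult.commute mult.left_commute)
      have "norm (- w m) \<le> (\<Sum>i. \<bar>b + c\<bar> * S * q (i + m))"
        unfolding sums_unique[OF sums]
        by (rule norm_suminf_le[OF le summable_mult[OF sq]])
      also have "\<dots> = \<bar>b + c\<bar> * S * (\<Sum>i. q (i + m))" by (rule suminf_mult[OF sq])
      also have "\<dots> \<le> \<bar>b + c\<bar> * S * T"
        using tail[OF m] S0 by (intro mult_left_mono) simp_all
      finally show ?thesis by simp
    qed
    have y_le: "\<bar>y m\<bar> \<le> \<bar>y n\<bar> + \<bar>c\<bar> * S * T" if m: "m \<ge> n" for m
    proof (cases "m = n")
      case True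
      have "T \<ge> 0" unfolding T_def by (intro suminf_nonneg sq q)
      thus ?thesis using True S0 by simp
    next
      case False
      then obtain k where k: "m = Suc k" "k \<ge> n" using m by (cases m) auto
      have "q k \<le> T"
        using sum_le_suminf[OF sq, of "{k - n}" n] q(1) k(2) by (simp add: T_def)
      hence "\<bar>c\<bar> * (\<bar>x k\<bar> * q k) \<le> \<bar>c\<bar> * (S * T)"
        using xS[OF k(2)] q(1)[of k] S0 by (intro mult_left_mono mult_mono) simp_all
      thus ?thesis using q(1)[of k] by (simp add: k(1) y abs_mult mult_ac)
    qed
    have "\<bar>x m\<bar> \<le> \<bar>y n\<bar> + S / 2" if m: "m \<ge> n" for m
    proof -
      have "\<bar>x m\<bar> \<le> \<bar>w m\<bar> + \<bar>y m\<bar>" by (simp add: w_def)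
      also have "\<dots> \<le> \<bar>y n\<bar> + S * (d * T)"
        using w_le[OF m] y_le[OF m] by (simp add: d_def algebra_simps)
      also have "\<dots> \<le> \<bar>y n\<bar> + S * (1 / 2)"
        using T S0 by (intro add_left_mono mult_left_mono)
      finally show ?thesis by simp
    qed
    hence "S \<le> \<bar>y n\<bar> + S / 2" unfolding S_def by (intro cSUP_least) auto
    thus ?thesis using xS[of n] by simp
  qed
  thus ?thesis by (rule that)
qed

section \<open>The matrix product\<close>

text \<open>The number \<open>1 / (j * (j - l))\<close> for \<open>j = l + n + 1\<close>, the index of the factor after the first \<open>n\<close>.\<close>
definition inv_quad :: "nat \<Rightarrow> nat \<Rightarrow> real" where
  "inv_quad l n = 1 / ((real n + 1) * (real n + 1 + real l))"

lemma inv_quad_nonneg: "inv_quad l n \<ge> 0"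
  by (simp add: inv_quad_def)

lemma inv_quad_summable: "summable (inv_quad l)"
proof (rule summable_comparison_test')
  show "summable (\<lambda>n. inverse (real (Suc n) ^ 2))"
    using inverse_power_summable[of 2, where 'a=real] by (subst summable_Suc_iff) simp
  show "norm (inv_quad l n) \<le> inverse (real (Suc n) ^ 2)" for n
    by (auto simp: inv_quad_def divide_simps power2_eq_square intro!: mult_mono)
qed

definition row_M_prod :: "nat \<Rightarrow> real \<Rightarrow> real \<Rightarrow> real^2 \<Rightarrow> nat \<Rightarrow> real^2" where
  "row_M_prod l lam mu v n = v v* M_prod l lam mu n"

lemma row_M_prod_0: "row_M_prod l lam mu v 0 = v"
  by (simp add: row_M_prod_def)

lemma row_M_prod_Suc:
  "row_M_prod l lam mu v (Suc n) $ 1 =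
     (1 + lam * inv_quad l n) * row_M_prod l lam mu v n $ 1 + row_M_prod l lam mu v n $ 2"
  "row_M_prod l lam mu v (Suc n) $ 2 = mu\<^sup>2 * inv_quad l n * row_M_prod l lam mu v n $ 1"
proof -
  have M: "M_mat l lam mu (l + Suc n) =
      vector [vector [1 + lam * inv_quad l n, mu\<^sup>2 * inv_quad l n], vector [1, 0]]"
    by (simp add: M_mat_def inv_quad_def algebra_simps)
  have R: "row_M_prod l lam mu v (Suc n) = row_M_prod l lam mu v n v* M_mat l lam mu (l + Suc n)"
    by (simp add: row_M_prod_def vector_matrix_mul_assoc)
  show "row_M_prod l lam mu v (Suc n) $ 1 =
     (1 + lam * inv_quad l n) * row_M_prod l lam mu v n $ 1 + row_M_prod l lam mu v n $ 2"
    "row_M_prod l lam mu v (Suc n) $ 2 = mu\<^sup>2 * inv_quad l n * row_M_prod l lam mu v n $ 1"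
    unfolding R M by (simp_all add: vector_matrix_mult_def sum_2 algebra_simps)
qed

lemma row_M_prod_limits:
  shows "convergent (\<lambda>n. row_M_prod l lam mu v n $ 1)" and "(\<lambda>n. row_M_prod l lam mu v n $ 2) \<longlonglongrightarrow> 0"
  using perturbed_recurrence_convergent[where x = "\<lambda>n. row_M_prod l lam mu v n $ 1"
      and y = "\<lambda>n. row_M_prod l lam mu v n $ 2", OF row_M_prod_Suc inv_quad_nonneg inv_quad_summable]
  by blast+

text \<open>
  The rows of the partial products are the orbits of the unit vectors, so entrywise convergence is
  an instance of convergence for recurrences.
\<close>
lemma M_prod_tendsto_R_mat: "M_prod l lam mu \<longlonglongrightarrow> R_mat l lam mu"
proof -
  have entry: "M_prod l lam mu n $ i $ j = row_M_prod l lam mu (axis i 1) n $ j" for n i j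
    by (simp add: row_M_prod_def vector_matrix_mult_def axis_def if_distrib if_distribR cong: if_cong)
  have "\<exists>L. (\<lambda>n. M_prod l lam mu n $ i $ j) \<longlonglongrightarrow> L" for i j
    using row_M_prod_limits[where v = "axis i 1" and l = l and lam = lam and mu = mu] exhaust_2[of j]
    by (auto simp: entry convergent_def)
  then obtain L where "\<And>i j. (\<lambda>n. M_prod l lam mu n $ i $ j) \<longlonglongrightarrow> L i j" by metis
  hence "M_prod l lam mu \<longlonglongrightarrow> (\<chi> i j. L i j)"
    by (intro vec_tendstoI) simp
  thus ?thesis unfolding R_mat_def using limI by metis
qed

abbreviation xi_row where "xi_row l lam mu \<equiv> row_M_prod l lam mu (vector [lam, mu\<^sup>2])"

lemma xi_row_tendsto_xi: "(\<lambda>n. xi_row l lam mu n $ 1) \<longlonglongrightarrow> xi l lam mu"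
proof -
  have "(\<lambda>n. (vector [lam, mu\<^sup>2] v* A n) $ 1) \<longlonglongrightarrow> (vector [lam, mu\<^sup>2] v* R) $ 1"
    if "A \<longlonglongrightarrow> R" for A and R :: "real^2^2"
    unfolding vector_matrix_mult_def by (auto intro!: tendsto_intros that)
  from this[OF M_prod_tendsto_R_mat] show ?thesis
    by (simp add: row_M_prod_def xi_def inner_vec_def sum_2)
qed

lemma xi_eq_0_imp_decay:
  assumes "xi l lam mu = 0"
  obtains N where "\<And>n. n \<ge> N \<Longrightarrow> \<bar>xi_row l lam mu n $ 1\<bar> \<le> 2 * \<bar>xi_row l lam mu n $ 2\<bar>"
  using perturbed_recurrence_vanishing_limit[where x = "\<lambda>n. xi_row l lam mu n $ 1"
      and y = "\<lambda>n. xi_row l lam mu n $ 2", OF row_M_prod_Suc inv_quad_nonneg inv_quad_summable]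
    xi_row_tendsto_xi[of l lam mu] assms by metis

section \<open>Entire solutions as everywhere convergent power series\<close>

text \<open>
  The coefficients of \<open>z ^ 0\<close> and \<open>z ^ (k + 1)\<close> in the equation; the former stands apart because the
  term with \<open>a (k - 1)\<close> is absent there.
\<close>
definition frobenius_recurrence :: "nat \<Rightarrow> real \<Rightarrow> real \<Rightarrow> (nat \<Rightarrow> complex) \<Rightarrow> bool" where
  "frobenius_recurrence l lam mu a \<longleftrightarrow>
     of_real lam * a 0 + of_real mu * a 1 = 0 \<and>
     (\<forall>k. ((of_nat k + 1) * (of_nat k + 1 + of_nat l) + of_real lam) * a (Suc k)
          + of_real mu * (of_nat k + 2) * a (Suc (Suc k))
          - of_real mu * (of_nat k + 1 + of_nat l) * a k = 0)"

text \<open>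
  The left-hand side of the equation is entire and its Taylor coefficients are the left-hand sides of
  the recurrence, so both vanish together by the identity theorem.
\<close>
lemma entire_solution_iff_recurrence:
  assumes holo: "E holomorphic_on UNIV" and F: "E has_fps_expansion F"
  shows "entire_solution l lam mu E \<longleftrightarrow> frobenius_recurrence l lam mu (fps_nth F)"
proof -
  define G where "G = (\<lambda>z. z\<^sup>2 * deriv (deriv E) z
     + ((of_nat l + 1) * z + of_real mu * (1 - z\<^sup>2)) * deriv E z
     + (of_real lam - of_real mu * (of_nat l + 1) * z) * E z)"
  define D where "D = fps_X\<^sup>2 * fps_deriv (fps_deriv F)
     + (fps_const (of_nat l + 1) * fps_X + fps_const (of_real mu) * (1 - fps_X\<^sup>2)) * fps_deriv F
     + (fps_const (of_real lam) - fps_const (of_real mu * (of_nat l + 1)) * fps_X) * F"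
  have G: "G has_fps_expansion D"
    unfolding G_def D_def by (intro fps_expansion_intros F)
  have "deriv E holomorphic_on UNIV" by (rule holomorphic_deriv[OF holo open_UNIV])
  moreover from this have "deriv (deriv E) holomorphic_on UNIV"
    by (rule holomorphic_deriv[OF _ open_UNIV])
  ultimately have Gholo: "G holomorphic_on UNIV"
    unfolding G_def by (intro holomorphic_intros holo open_UNIV)
  have "entire_solution l lam mu E \<longleftrightarrow> (\<forall>z. G z = 0)"
    using holo by (simp add: entire_solution_def solves_ode_at_def G_def)
  also have "\<dots> \<longleftrightarrow> D = 0"
  proof
    assume "\<forall>z. G z = 0"
    hence "G has_fps_expansion 0" by (simp add: has_fps_expansion_0_iff)
    thus "D = 0" using G fps_expansion_unique_complex by blast
  next
    assume "D = 0"
    thus "\<forall>z. G z = 0"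
      using has_fps_expansion_0_analytic_continuation[of G UNIV] G Gholo by auto
  qed
  also have "\<dots> \<longleftrightarrow> frobenius_recurrence l lam mu (fps_nth F)"
  proof -
    \<comment> \<open>With the powers of \<open>fps_X\<close> on the left of each product, coefficients are read off by shifting.\<close>
    have D_expand: "D = fps_X\<^sup>2 * fps_deriv (fps_deriv F)
        + fps_const (of_nat l + 1) * (fps_X * fps_deriv F) + fps_const (of_real mu) * fps_deriv F
        - fps_const (of_real mu) * (fps_X\<^sup>2 * fps_deriv F) + fps_const (of_real lam) * F
        - fps_const (of_real mu * (of_nat l + 1)) * (fps_X * F)"
      unfolding D_def by (simp only: ring_distribs mult.assoc mult_1_left) simp
    note nth = fps_add_nth fps_sub_nth fps_mult_left_const_nth fps_X_power_mult_nth
      fps_X_mult_nth fps_deriv_nth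
    have D0: "fps_nth D 0 = of_real lam * fps_nth F 0 + of_real mu * fps_nth F 1"
      by (simp add: D_def algebra_simps fps_X_power_mult_nth)
    have DS: "fps_nth D (Suc k) =
      ((of_nat k + 1) * (of_nat k + 1 + of_nat l) + of_real lam) * fps_nth F (Suc k)
          + of_real mu * (of_nat k + 2) * fps_nth F (Suc (Suc k))
          - of_real mu * (of_nat k + 1 + of_nat l) * fps_nth F k" for k
    proof (cases k)
      case 0
      show ?thesis unfolding D_expand 0 nth by (simp, simp add: algebra_simps)
    next
      case (Suc j)
      show ?thesis unfolding D_expand Suc nth
        by (simp add: numeral_2_eq_2 del: of_nat_Suc, simp add: algebra_simps)
    qed
    have "D = 0 \<longleftrightarrow> fps_nth D 0 = 0 \<and> (\<forall>k. fps_nth D (Suc k) = 0)"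
      by (metis fps_ext fps_zero_nth not0_implies_Suc)
    thus ?thesis unfolding frobenius_recurrence_def D0 DS .
  qed
  finally show ?thesis .
qed

lemma ex_entire_solution_iff:
  "(\<exists>E. entire_solution l lam mu E \<and> (\<exists>z. E z \<noteq> 0)) \<longleftrightarrow>
   (\<exists>a. frobenius_recurrence l lam mu a \<and> (\<exists>n. a n \<noteq> 0) \<and> (\<forall>z. summable (\<lambda>n. a n * z ^ n)))"
  (is "?L \<longleftrightarrow> ?R")
proof
  assume ?L
  then obtain E z where E: "entire_solution l lam mu E" "E z \<noteq> 0" by blast
  have holo: "E holomorphic_on UNIV" using E(1) by (simp add: entire_solution_def)
  define F where "F = fps_expansion E 0"
  have F: "E has_fps_expansion F"
    unfolding F_def using holo by (intro has_fps_expansion_fps_expansion[of UNIV]) auto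
  have rad: "fps_conv_radius F = \<infinity>"
    unfolding F_def using conv_radius_fps_expansion[of E 0 \<infinity>] holo by simp
  have "F \<noteq> 0"
    using has_fps_expansion_0_analytic_continuation[of E UNIV] F holo E(2) by auto
  hence "\<exists>n. fps_nth F n \<noteq> 0" by (metis fps_ext fps_zero_nth)
  moreover have "summable (\<lambda>n. fps_nth F n * z ^ n)" for z
    using rad by (intro summable_fps) simp
  moreover have "frobenius_recurrence l lam mu (fps_nth F)"
    using entire_solution_iff_recurrence[OF holo F] E(1) by simp
  ultimately show ?R by blast
next
  assume ?R
  then obtain a n where a: "frobenius_recurrence l lam mu a" "a n \<noteq> 0"
      "\<And>z. summable (\<lambda>n. a n * z ^ n)" by blast
  define F where "F = Abs_fps a"
  have rad: "fps_conv_radius F = \<infinity>"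
    unfolding fps_conv_radius_def F_def using a(3) by (intro conv_radius_inftyI'') simp
  have F: "eval_fps F has_fps_expansion F"
    by (rule eval_fps_has_fps_expansion) (simp add: rad)
  have holo: "eval_fps F holomorphic_on UNIV"
    by (intro holomorphic_intros) (simp add: rad)
  have "entire_solution l lam mu (eval_fps F)"
    using entire_solution_iff_recurrence[OF holo F] a(1) by (simp add: F_def fps_nth_Abs_fps[abs_def])
  moreover have "\<exists>z. eval_fps F z \<noteq> 0"
  proof (rule ccontr)
    assume "\<not> (\<exists>z. eval_fps F z \<noteq> 0)"
    hence "eval_fps F has_fps_expansion 0" by (simp add: has_fps_expansion_0_iff)
    hence "F = 0" using F fps_expansion_unique_complex by blast
    thus False using a(2) by (simp add: F_def fps_eq_iff)
  qed
  ultimately show ?L by blast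
qed


section \<open>The case of positive \<open>mu\<close>\<close>

text \<open>
  The factor between \<open>\<bar>a (n + 1)\<bar>\<close> and the absolute value of the first entry of the row vector,
  when \<open>a 0 = 1\<close>. It solves the two-term recurrence
  \<open>mu (n + 2) h (n + 1) = (n + 1) (n + 1 + l) h n\<close> with \<open>mu * h 0 = 1\<close>, that is, the dominant part
  of the recurrence for the coefficients, up to the sign.
\<close>
definition coeff_scale :: "nat \<Rightarrow> real \<Rightarrow> nat \<Rightarrow> real" where
  "coeff_scale l mu n = fact (n + l) / (fact l * (real n + 1) * mu ^ Suc n)"

lemma coeff_scale_pos: "mu > 0 \<Longrightarrow> coeff_scale l mu n > 0"
  by (simp add: coeff_scale_def)

lemma coeff_scale_Suc:
  assumes "mu > 0"
  shows "mu * (real n + 2) * coeff_scale l mu (Suc n) =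
    (real n + 1) * (real n + 1 + real l) * coeff_scale l mu n"
proof -
  have "coeff_scale l mu (Suc n) =
      (real n + 1 + real l) * fact (n + l) / (fact l * (real n + 2) * (mu * mu ^ Suc n))"
    by (simp add: coeff_scale_def add_ac)
  thus ?thesis using assms by (simp add: coeff_scale_def del: power_Suc)
qed

text \<open>
  Factorial growth is more than needed: a geometric lower bound suffices to exclude convergence of
  the series at the single point \<open>2 * mu\<close> unless the row vectors tend to \<open>0\<close>.
\<close>
lemma coeff_scale_lower_bound:
  assumes "mu > 0"
  shows "coeff_scale l mu n * (2 * mu) ^ Suc n \<ge> 1"
proof -
  have "real n + 1 \<le> 2 ^ Suc n" using of_nat_less_two_power[of "Suc n", where 'a = real] by simp
  moreover have "fact l \<le> (fact (n + l) :: real)" by (intro fact_mono) simp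
  ultimately have "fact l * (real n + 1) \<le> fact (n + l) * 2 ^ Suc n"
    by (intro mult_mono) simp_all
  thus ?thesis using assms
    by (simp add: coeff_scale_def power_mult_distrib divide_simps del: power_Suc)
qed

text \<open>
  The second entry of the row vector is a multiple of the preceding first entry and therefore encodes
  the preceding coefficient. Setting \<open>y 0 = mu\<^sup>2\<close> makes this correct for \<open>n = 0\<close> as well.
\<close>
lemma coeff_eq_xi_row_snd:
  assumes mu: "mu > 0"
    and X: "\<And>m. n = Suc m \<Longrightarrow>
      a n = of_real ((-1) ^ n * coeff_scale l mu m * xi_row l lam mu m $ 1) * a 0"
  shows "of_real mu * a n =
    of_real ((-1) ^ n * (real n + 1) * coeff_scale l mu n * xi_row l lam mu n $ 2) * a 0"
proof (cases n)
  case 0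
  thus ?thesis using mu by (simp add: row_M_prod_0 coeff_scale_def power2_eq_square)
next
  case (Suc m)
  let ?x = "xi_row l lam mu m $ 1"
  have "(real n + 1) * coeff_scale l mu n * xi_row l lam mu n $ 2
      = mu * (real m + 2) * coeff_scale l mu (Suc m) * (mu * inv_quad l m * ?x)"
    by (simp add: Suc row_M_prod_Suc power2_eq_square algebra_simps)
  also have "\<dots> = mu * (coeff_scale l mu m * ?x)"
    unfolding coeff_scale_Suc[OF mu] by (simp add: inv_quad_def divide_simps)
  finally have "(-1) ^ n * (real n + 1) * coeff_scale l mu n * xi_row l lam mu n $ 2
      = mu * ((-1) ^ n * coeff_scale l mu m * ?x)"
    by (simp add: mult_ac)
  thus ?thesis unfolding X[OF Suc] by (simp only: of_real_mult mult.assoc)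
qed

text \<open>
  With \<open>a (n + 1)\<close> and \<open>a n\<close> expressed by the two entries of the \<open>n\<close>-th row vector, the recurrence for
  \<open>a (n + 2)\<close> becomes, up to nonzero factors, the first column of \<open>M\<^sub>l\<^sub>+\<^sub>n\<^sub>+\<^sub>1\<close>.
\<close>
lemma frobenius_recurrence_iff_xi_row:
  assumes mu: "mu > 0"
  shows "frobenius_recurrence l lam mu a \<longleftrightarrow>
    (\<forall>n. a (Suc n) = of_real ((-1) ^ Suc n * coeff_scale l mu n * xi_row l lam mu n $ 1) * a 0)"
    (is "_ \<longleftrightarrow> (\<forall>n. ?X n)")
proof -
  let ?x = "\<lambda>n. xi_row l lam mu n $ 1" and ?y = "\<lambda>n. xi_row l lam mu n $ 2"
  let ?h = "coeff_scale l mu" and ?c = "\<lambda>n. (real n + 1) * (real n + 1 + real l)"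
  let ?rec = "\<lambda>k. ((of_nat k + 1) * (of_nat k + 1 + of_nat l) + of_real lam) * a (Suc k)
          + of_real mu * (of_nat k + 2) * a (Suc (Suc k))
          - of_real mu * (of_nat k + 1 + of_nat l) * a k = 0"
  have h0: "mu * ?h 0 = 1" using mu by (simp add: coeff_scale_def)
  have base: "?X 0 \<longleftrightarrow> of_real lam * a 0 + of_real mu * a 1 = 0"
  proof -
    have "complex_of_real mu \<noteq> 0" using mu by simp
    hence "?X 0 \<longleftrightarrow> of_real mu * a (Suc 0) = of_real mu * (of_real (- ?h 0 * lam) * a 0)"
      unfolding mult_cancel_left by (simp add: row_M_prod_0)
    also have "of_real mu * (of_real (- ?h 0 * lam) * a 0) = of_real (- (mu * ?h 0) * lam) * a 0"
      by simp
    finally show ?thesis by (simp add: h0 add_eq_0_iff add.commute)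
  qed
  have step: "?rec n \<longleftrightarrow> ?X (Suc n)" if X: "\<And>m. m \<le> n \<Longrightarrow> ?X m" for n
  proof -
    define e where "e = ((-1) ^ n :: real)"
    have Y: "of_real mu * a n = of_real (e * (real n + 1) * ?h n * ?y n) * a 0"
      unfolding e_def using X by (intro coeff_eq_xi_row_snd[OF mu]) simp
    have X': "a (Suc n) = of_real (- e * ?h n * ?x n) * a 0"
      unfolding X[OF order_refl] by (simp add: e_def)
    have "?rec n \<longleftrightarrow> of_real mu * (of_nat n + 2) * a (Suc (Suc n)) =
        of_real (real n + 1 + real l) * (of_real mu * a n) - of_real (?c n + lam) * a (Suc n)"
      by (simp add: algebra_simps)
    also have "of_real (real n + 1 + real l) * (of_real mu * a n) - of_real (?c n + lam) * a (Suc n) =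
        of_real (e * ?h n * ((?c n + lam) * ?x n + ?c n * ?y n)) * a 0"
      unfolding X' Y by (simp add: algebra_simps)
    also have "(?c n + lam) * ?x n + ?c n * ?y n = ?c n * ?x (Suc n)"
    proof -
      have "?c n * ?x (Suc n) = (?c n + lam * (?c n * inv_quad l n)) * ?x n + ?c n * ?y n"
        unfolding row_M_prod_Suc by (simp only: algebra_simps)
      thus ?thesis by (simp add: inv_quad_def)
    qed
    also have "e * ?h n * (?c n * ?x (Suc n)) = mu * (real n + 2) * (e * ?h (Suc n) * ?x (Suc n))"
      using arg_cong[OF coeff_scale_Suc[OF mu, of n l], of "\<lambda>t. t * (e * ?x (Suc n))"]
      by (simp only: mult_ac)
    also have "of_real mu * (of_nat n + 2) * a (Suc (Suc n)) =
        of_real (mu * (real n + 2) * (e * ?h (Suc n) * ?x (Suc n))) * a 0 \<longleftrightarrow>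
        of_real (mu * (real n + 2)) * a (Suc (Suc n)) =
        of_real (mu * (real n + 2)) * (of_real (e * ?h (Suc n) * ?x (Suc n)) * a 0)"
      by (simp only: of_real_mult of_real_add of_real_of_nat_eq of_real_numeral mult.assoc)
    also have "\<dots> \<longleftrightarrow> a (Suc (Suc n)) = of_real (e * ?h (Suc n) * ?x (Suc n)) * a 0"
    proof -
      have "mu * (real n + 2) \<noteq> 0" using mu by simp
      thus ?thesis by (metis mult_cancel_left of_real_eq_0_iff)
    qed
    finally show ?thesis by (simp add: e_def)
  qed
  show ?thesis
  proof
    assume rec: "frobenius_recurrence l lam mu a"
    show "\<forall>n. ?X n"
    proof
      fix n show "?X n"
      proof (induction n rule: less_induct)
        case (less n)
        show ?case
        proof (cases n)
          case 0
          thus ?thesis using base rec unfolding frobenius_recurrence_def by blast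
        next
          case (Suc m)
          have "?X k" if "k \<le> m" for k using less.IH that Suc by simp
          thus ?thesis using step[of m] rec unfolding frobenius_recurrence_def Suc by blast
        qed
      qed
    qed
  next
    assume "\<forall>n. ?X n"
    thus "frobenius_recurrence l lam mu a"
      using base step unfolding frobenius_recurrence_def by blast
  qed
qed

lemma summable_imp_xi_eq_0:
  assumes mu: "mu > 0" and rec: "frobenius_recurrence l lam mu a" and nz: "\<exists>n. a n \<noteq> 0"
    and sm: "\<And>z. summable (\<lambda>n. a n * z ^ n)"
  shows "xi l lam mu = 0"
proof -
  let ?x = "\<lambda>n. xi_row l lam mu n $ 1"
  have X: "a (Suc n) = of_real ((-1) ^ Suc n * coeff_scale l mu n * ?x n) * a 0" for n
    using rec frobenius_recurrence_iff_xi_row[OF mu] by blast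
  have a0: "a 0 \<noteq> 0"
  proof
    assume "a 0 = 0"
    hence "a n = 0" for n using X by (cases n) simp_all
    thus False using nz by blast
  qed
  have "(\<lambda>n. norm (a (Suc n) * of_real (2 * mu) ^ Suc n)) \<longlonglongrightarrow> 0"
    using summable_LIMSEQ_zero[OF sm[of "of_real (2 * mu)"]]
    by (intro tendsto_norm_zero LIMSEQ_Suc)
  hence "(\<lambda>n. norm (a (Suc n) * of_real (2 * mu) ^ Suc n) / norm (a 0)) \<longlonglongrightarrow> 0"
    using a0 by (intro tendsto_divide_zero)
  moreover have "norm (?x n) \<le> norm (a (Suc n) * of_real (2 * mu) ^ Suc n) / norm (a 0)" for n
  proof -
    have "1 * \<bar>?x n\<bar> \<le> (coeff_scale l mu n * (2 * mu) ^ Suc n) * \<bar>?x n\<bar>"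
      by (intro mult_right_mono coeff_scale_lower_bound mu) simp
    also have "\<dots> = norm (a (Suc n) * of_real (2 * mu) ^ Suc n) / norm (a 0)"
      using mu a0 coeff_scale_pos[OF mu, of l n]
      by (simp add: X norm_mult norm_power abs_mult power_abs)
    finally show ?thesis by simp
  qed
  ultimately have "?x \<longlonglongrightarrow> 0" by (intro Lim_null_comparison[where f = ?x]) auto
  thus ?thesis using xi_row_tendsto_xi LIMSEQ_unique by blast
qed

text \<open>
  The bound \<open>\<bar>x n\<bar> \<le> 2 * \<bar>y n\<bar>\<close> compares \<open>a (n + 1)\<close> with \<open>a n\<close>, as \<open>y n\<close> encodes \<open>a n\<close>; the scaling
  factors cancel up to \<open>mu / (n + 1)\<close>, and the ratio test applies at every point.
\<close>
lemma xi_eq_0_imp_entire_series: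
  assumes mu: "mu > 0" and xi: "xi l lam mu = 0"
  obtains a where "frobenius_recurrence l lam mu a" "a 0 = 1" "\<And>z. summable (\<lambda>n. a n * z ^ n)"
proof -
  let ?x = "\<lambda>n. xi_row l lam mu n $ 1" and ?y = "\<lambda>n. xi_row l lam mu n $ 2"
  let ?h = "coeff_scale l mu"
  define a :: "nat \<Rightarrow> complex" where
    "a = (\<lambda>n. case n of 0 \<Rightarrow> 1 | Suc m \<Rightarrow> of_real ((-1) ^ Suc m * ?h m * ?x m))"
  have a0: "a 0 = 1" and X: "a (Suc n) = of_real ((-1) ^ Suc n * ?h n * ?x n) * a 0" for n
    by (simp_all add: a_def)
  have Y: "of_real mu * a n = of_real ((-1) ^ n * (real n + 1) * ?h n * ?y n) * a 0" for n
    using X by (intro coeff_eq_xi_row_snd[OF mu]) simp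
  have rec: "frobenius_recurrence l lam mu a"
    using frobenius_recurrence_iff_xi_row[OF mu] X by blast
  obtain N where N: "\<And>n. n \<ge> N \<Longrightarrow> \<bar>?x n\<bar> \<le> 2 * \<bar>?y n\<bar>"
    using xi_eq_0_imp_decay[OF xi] by blast
  have ratio: "(real n + 1) * norm (a (Suc n)) \<le> 2 * mu * norm (a n)" if "n \<ge> N" for n
  proof -
    have hp: "?h n > 0" by (rule coeff_scale_pos[OF mu])
    have "norm (a (Suc n)) = ?h n * \<bar>?x n\<bar>"
      using hp by (simp add: X a0 norm_mult norm_power abs_mult)
    also have "\<dots> \<le> ?h n * (2 * \<bar>?y n\<bar>)" using N[OF that] hp by (intro mult_left_mono) simp_all
    finally have "(real n + 1) * norm (a (Suc n)) \<le> 2 * ((real n + 1) * ?h n * \<bar>?y n\<bar>)"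
      by (simp add: mult_left_mono mult_ac)
    also have "(real n + 1) * ?h n * \<bar>?y n\<bar> = norm (of_real mu * a n)"
      unfolding Y a0 using hp by (simp add: norm_mult norm_power abs_mult del: of_real_mult of_real_add)
    finally show ?thesis using mu by (simp add: norm_mult)
  qed
  have "summable (\<lambda>n. a n * z ^ n)" for z
  proof (rule summable_ratio_test)
    \<comment> \<open>From \<open>max N K\<close> on, the ratio of consecutive terms is at most
        \<open>2 * mu * norm z / (n + 1)\<close> and hence at most \<open>1 / 2\<close>.\<close>
    define K where "K = nat \<lceil>4 * mu * norm z\<rceil>"
    fix n assume n: "n \<ge> max N K"
    have "4 * mu * norm z \<le> real n + 1" using n unfolding K_def by linarith
    hence "4 * mu * norm z * norm (a n) \<le> (real n + 1) * norm (a n)"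
      by (rule mult_right_mono) simp
    moreover have "(real n + 1) * norm (a (Suc n)) * norm z \<le> 2 * mu * norm (a n) * norm z"
      using n by (intro mult_right_mono ratio) simp_all
    ultimately have "(real n + 1) * (norm (a (Suc n)) * norm z) \<le> (real n + 1) * (1 / 2 * norm (a n))"
      by (simp add: algebra_simps)
    hence "norm (a (Suc n)) * norm z \<le> 1 / 2 * norm (a n)"
      by (rule mult_left_le_imp_le) simp
    from mult_right_mono[OF this, of "norm z ^ n"]
    show "norm (a (Suc n) * z ^ Suc n) \<le> 1 / 2 * norm (a n * z ^ n)"
      by (simp add: norm_mult norm_power mult_ac)
  qed simp
  thus ?thesis using that rec a0 by blast
qed

section \<open>The case \<open>mu = 0\<close> and the equivalence\<close>

lemma xi_row_eq_0_iff_mu_0: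
  "xi_row l lam 0 n $ 1 = 0 \<longleftrightarrow> (\<exists>k\<le>n. real k * (real k + real l) + lam = 0)"
proof (induction n)
  case (Suc n)
  have y: "xi_row l lam 0 n $ 2 = 0" by (cases n) (simp_all add: row_M_prod_0 row_M_prod_Suc)
  have "1 + lam * inv_quad l n = 0 \<longleftrightarrow>
      real (Suc n) * (real (Suc n) + real l) + lam = 0"
    by (simp add: inv_quad_def divide_simps add_ac)
  hence "xi_row l lam 0 (Suc n) $ 1 = 0 \<longleftrightarrow>
      real (Suc n) * (real (Suc n) + real l) + lam = 0 \<or> xi_row l lam 0 n $ 1 = 0"
    unfolding row_M_prod_Suc(1) y by simp
  thus ?case unfolding Suc by (auto simp: le_Suc_eq)
qed (simp add: row_M_prod_0)

text \<open>
  An infinite product of factors \<open>1 + lam * q n\<close> with \<open>q\<close> summable vanishes only if a factor does. The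
  decay estimate gives this at once: as \<open>y = 0\<close>, it says that \<open>x\<close> vanishes from some index on.
\<close>
lemma xi_eq_0_iff_mu_0:
  "xi l lam 0 = 0 \<longleftrightarrow> (\<exists>k. real k * (real k + real l) + lam = 0)"
proof
  assume "xi l lam 0 = 0"
  from xi_eq_0_imp_decay[OF this] obtain N where
    "\<bar>xi_row l lam 0 (Suc N) $ 1\<bar> \<le> 2 * \<bar>xi_row l lam 0 (Suc N) $ 2\<bar>"
    by (metis le_SucI order_refl)
  hence "xi_row l lam 0 (Suc N) $ 1 = 0" by (simp add: row_M_prod_Suc(2))
  thus "\<exists>k. real k * (real k + real l) + lam = 0"
    unfolding xi_row_eq_0_iff_mu_0 by blast
next
  assume "\<exists>k. real k * (real k + real l) + lam = 0"
  then obtain k where k: "real k * (real k + real l) + lam = 0" by blast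
  have "eventually (\<lambda>n. xi_row l lam 0 n $ 1 = 0) sequentially"
    unfolding xi_row_eq_0_iff_mu_0
    by (rule eventually_mono[OF eventually_ge_at_top[of k]]) (use k in blast)
  hence "(\<lambda>n. xi_row l lam 0 n $ 1) \<longlonglongrightarrow> 0" by (rule tendsto_eventually)
  thus "xi l lam 0 = 0" using xi_row_tendsto_xi LIMSEQ_unique by blast
qed

lemma frobenius_recurrence_mu_0:
  "frobenius_recurrence l lam 0 a \<longleftrightarrow> (\<forall>k. real k * (real k + real l) + lam = 0 \<or> a k = 0)"
proof -
  let ?P = "\<lambda>k. of_real (real k * (real k + real l) + lam) * a k = 0"
  have "frobenius_recurrence l lam 0 a \<longleftrightarrow> ?P 0 \<and> (\<forall>k. ?P (Suc k))"
    unfolding frobenius_recurrence_def by (simp add: add_ac)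
  also have "\<dots> \<longleftrightarrow> (\<forall>k. ?P k)" by (metis not0_implies_Suc)
  also have "\<dots> \<longleftrightarrow> (\<forall>k. real k * (real k + real l) + lam = 0 \<or> a k = 0)"
    by (simp only: mult_eq_0_iff of_real_eq_0_iff)
  finally show ?thesis .
qed

theorem theorem3p5:
  fixes l :: nat and lam mu :: real
  assumes "mu \<ge> 0"
  shows "(\<exists>E. entire_solution l lam mu E \<and> (\<exists>z. E z \<noteq> 0)) \<longleftrightarrow> xi l lam mu = 0"
proof (cases "mu = 0")
  case False
  hence mu: "mu > 0" using assms by simp
  show ?thesis
    unfolding ex_entire_solution_iff
    using summable_imp_xi_eq_0[OF mu] xi_eq_0_imp_entire_series[OF mu] zero_neq_one by metis
next
  case True
  have "(\<exists>a. frobenius_recurrence l lam 0 a \<and> (\<exists>n. a n \<noteq> 0) \<and> (\<forall>z. summable (\<lambda>n. a n * z ^ n)))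
      \<longleftrightarrow> (\<exists>k. real k * (real k + real l) + lam = 0)"
  proof
    assume "\<exists>k. real k * (real k + real l) + lam = 0"
    then obtain k where k: "real k * (real k + real l) + lam = 0" by blast
    define a :: "nat \<Rightarrow> complex" where "a = (\<lambda>n. if n = k then 1 else 0)"
    have "summable (\<lambda>n. a n * z ^ n)" for z
      by (rule summable_finite[of "{k}"]) (simp_all add: a_def)
    moreover have "frobenius_recurrence l lam 0 a" "a k \<noteq> 0"
      using k by (simp_all add: frobenius_recurrence_mu_0 a_def)
    ultimately show "\<exists>a. frobenius_recurrence l lam 0 a \<and> (\<exists>n. a n \<noteq> 0) \<and>
        (\<forall>z. summable (\<lambda>n. a n * z ^ n))" by blast
  qed (auto simp: frobenius_recurrence_mu_0)
  thus ?thesis unfolding True ex_entire_solution_iff xi_eq_0_iff_mu_0 .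
qed

end
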